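(* Let $n\ge 1$, let $N$ and $V$ be finite disjoint sets with $|N|=|V|=n$, and let $Q\subseteq\mathbb{R}^{n^3}$ be the polyhedron of achievable probabilities. For every $i\in N$ and every $t\in[n]$, the inequality $$\sum_{j\in V} z_{ij}^t\le \frac1n$$ is facet-defining for $Q$.
   Context: $[n]=\{1,\dots,n\}$; singletons are identified with their element. Online bipartite matching model: $N$ is the set of impression types, $V$ the set of ads, $|N|=|V|=n$, and there are $n$ stages, counted down $t=n,n-1,\dots,1$ (stage $n$ is first; $t$ is the number of remaining decision epochs including the current one). At each stage an impression type is drawn independently and uniformly from $N$ and must be immediately and irrevocably matched to a still-available ad of $V$ or discarded; each ad is matched at most once. All pairs in $N\times V$ may be matched. Polyhedron of achievable probabilities $Q$. Consider nonnegative variables $x_{i,j}^{t,S}$ for $t\in[n]$, $i\in N$, $j\in V$, $S\subseteq V\setminus j$ with $|S|\ge t-1$ (probability that in stage $t$ type $i$ appears, the available ads are $S\cup j$, and $i$ is matched to $j$), and $y_i^{t,S}$ for $t\in[n]$, $i\in N$, $S\subseteq V$ with $|S|\ge t$ (probability that in stage $t$ type $i$ appears, the available ads are $S$, and $i$ is discarded), subject to (a) $\sum_{j\in V}x_{i,j}^{n,V\setminus j}+y_i^{n,V}\le \frac1n$ for $i\in N$; (b) $\sum_{j\in S}x_{i,j}^{t,S\setminus j}+y_i^{t,S}1_{\{t\ne1\}}-\frac1n 1_{\{|S|>t\}}\sum_{k\in N}y_k^{t+1,S}-\frac1n\sum_{k\in N}\sum_{j\in V\setminus S}x_{k,j}^{t+1,S}\le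 0$ for $t\in[n-1]$, $i\in N$, $\emptyset\ne S\subsetneq V$ with $|S|\ge t$; (c) $\sum_{j\in V}x_{i,j}^{t,V\setminus j}+y_i^{t,V}1_{\{t\ne1\}}-\frac1n\sum_{k\in N}y_k^{t+1,V}\le0$ for $t\in[n-1]$, $i\in N$. Here $1_{\mathcal A}$ is $1$ if condition $\mathcal A$ holds and $0$ otherwise. $Q$ is the set of $z=(z_{ij}^t)_{i\in N,j\in V,t\in[n]}\in\mathbb{R}^{n^3}$ for which there is a feasible $(x,y)\ge0$ with $z_{ij}^t=\sum_{S}x_{i,j}^{t,S}$ (sum over $S\subseteq V\setminus j$ with $|S|\ge t-1$). Thus $z_{ij}^t$ is the probability that impression type $i$ is matched to ad $j$ in stage $t$ under some feasible policy. $Q$ is full-dimensional in $\mathbb{R}^{n^3}$. An inequality is facet-defining for $Q$ if it is valid for $Q$ and the set of points of $Q$ satisfying it with equality has dimension $n^3-1$. *)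

theory Defs
  imports "HOL-Analysis.Analysis"
begin

text \<open>
  The impression types are the elements of a finite type \<open>'i\<close> and the ads those of a
  finite type \<open>'v\<close>, with \<open>CARD('i) = CARD('v) = n\<close>. The type \<open>'v stage\<close> is the
  index set \<open>{1..n}\<close> of the stages, so that \<open>real ^ 'v ^ 'i ^ 'v stage\<close> is
  $R^{n^3}$ and \<open>z $ t $ i $ j\<close> is $z_{ij}^t$.
\<close>

typedef ('v::finite) stage = "{1..CARD('v)}"
  morphisms stage_no Abs_stage
  by (rule exI[of _ 1]) (simp add: Suc_le_eq)

instance stage :: (finite) finite
proof
  have "finite (Abs_stage ` {1..CARD('a)} :: 'a stage set)"
    by simp
  then show "finite (UNIV :: 'a stage set)"
    by (simp add: type_definition.univ[OF type_definition_stage])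
qed

lemma card_stage: "CARD('v::finite stage) = CARD('v)"
  by (simp add: type_definition.card[OF type_definition_stage])

text \<open>
  \<open>x t S i j\<close> and \<open>y t S i\<close> stand for $x_{i,j}^{t,S}$ and $y_i^{t,S}$. They are
  total functions; only their values at the index ranges appearing in the
  nonnegativity conditions are variables of the system, and no other value
  contributes to any of the constraints or to \<open>achievable\<close>.
\<close>

definition feasible ::
  "(nat \<Rightarrow> 'v::finite set \<Rightarrow> 'i::finite \<Rightarrow> 'v \<Rightarrow> real) \<Rightarrow> (nat \<Rightarrow> 'v set \<Rightarrow> 'i \<Rightarrow> real) \<Rightarrow> bool"
  where
  "feasible x y \<longleftrightarrow>
    (let n = CARD('v) in
      (\<forall>t\<in>{1..n}. \<forall>i j S. S \<subseteq> UNIV - {j} \<and> card S \<ge> t - 1 \<longrightarrow> x t S i j \<ge> 0) \<and>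
      (\<forall>t\<in>{1..n}. \<forall>i S. card S \<ge> t \<longrightarrow> y t S i \<ge> 0) \<and>
      (\<forall>i. (\<Sum>j\<in>UNIV. x n (UNIV - {j}) i j) + y n UNIV i \<le> 1 / real n) \<and>
      (\<forall>t\<in>{1..n-1}. \<forall>i S. S \<noteq> {} \<and> S \<subset> UNIV \<and> card S \<ge> t \<longrightarrow>
        (\<Sum>j\<in>S. x t (S - {j}) i j) + y t S i * of_bool (t \<noteq> 1)
          - 1 / real n * of_bool (card S > t) * (\<Sum>k\<in>UNIV. y (t + 1) S k)
          - 1 / real n * (\<Sum>k\<in>UNIV. \<Sum>j\<in>UNIV - S. x (t + 1) S k j) \<le> 0) \<and>
      (\<forall>t\<in>{1..n-1}. \<forall>i.
        (\<Sum>j\<in>UNIV. x t (UNIV - {j}) i j) + y t UNIV i * of_bool (t \<noteq> 1)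
          - 1 / real n * (\<Sum>k\<in>UNIV. y (t + 1) UNIV k) \<le> 0))"

definition achievable :: "(real ^ 'v::finite ^ 'i::finite ^ 'v stage) set" where
  "achievable = {z. \<exists>x y. feasible x y \<and>
     (\<forall>t i j. z $ t $ i $ j =
        (\<Sum>S | S \<subseteq> UNIV - {j} \<and> card S \<ge> stage_no t - 1. x (stage_no t) S i j))}"

text \<open>
  For a full-dimensional polyhedron \<open>Q\<close> and a linear functional \<open>f\<close>: the
  inequality \<open>f z \<le> b\<close> is facet-defining for \<open>Q\<close>.
\<close>

definition facet_defining :: "'a::euclidean_space set \<Rightarrow> ('a \<Rightarrow> real) \<Rightarrow> real \<Rightarrow> bool" where
  "facet_defining Q f b \<longleftrightarrow>
     (\<forall>z\<in>Q. f z \<le> b) \<and> aff_dim {z\<in>Q. f z = b} = int DIM('a) - 1"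

lemma DIM_achievable:
  assumes "CARD('i::finite) = CARD('v::finite)"
  shows "DIM(real ^ 'v ^ 'i ^ 'v stage) = CARD('v) ^ 3"
  using assms by (simp add: card_stage power3_eq_cube)

end

theory Submission
  imports Defs
begin

text \<open>
  Validity: summed over all sets of available ads, the constraints say that in each stage
  the total mass of each type is at most $1/n$, by downward induction on the stage.
  Dimension: the face contains the points where type \<open>i\<close> is matched in stage \<open>t\<close> to one
  fixed ad, everything else being discarded, and the points where in addition another type, or
  the type of another stage, is matched to one ad that does not conflict with the first.
  These already affinely span the hyperplane.
\<close>

section \<open>Validity: conservation of mass over the sets of available ads\<close>

text \<open>
  The discards of stage 1 are left out for $n > 1$, since the constraints then do not bound
  them.
\<close>

lemma feasible_mass_le:
  fixes x :: "nat \<Rightarrow> 'v::finite set \<Rightarrow> 'i::finite \<Rightarrow> 'v \<Rightarrow> real"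
  assumes feas: "feasible x y" and card: "CARD('i) = CARD('v)"
    and r: "1 \<le> r" "r \<le> CARD('v)"
  shows "(\<Sum>S | r \<le> card S. (\<Sum>j\<in>S. x r (S - {j}) k j) + y r S k * of_bool (r \<noteq> 1 \<or> r = CARD('v)))
           \<le> 1 / real CARD('v)"
  using r(2,1)
proof (induction r arbitrary: k rule: inc_induct)
  case base
  have "{S :: 'v set. CARD('v) \<le> card S} = {UNIV}"
    using card_seteq[of "UNIV :: 'v set"] by auto
  then show ?case
    using feas by (simp add: feasible_def Let_def)
next
  case (step r)
  let ?n = "CARD('v)"
  \<comment> \<open>The mass arriving at the available set \<open>S\<close> from stage
    \<open>r + 1\<close>: a discard keeps \<open>S\<close>, a match of some \<open>j\<close> outside
    \<open>S\<close> comes from \<open>insert j S\<close>. Only for \<open>card S > r\<close> is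
    \<open>y (r + 1) S\<close> a variable of the system.\<close>
  let ?inflow = "\<lambda>S. of_bool (card S > r) * (\<Sum>k\<in>UNIV. y (r + 1) S k)
      + (\<Sum>k\<in>UNIV. \<Sum>j\<in>-S. x (r + 1) S k j)"
  have r: "r \<in> {1..?n - 1}" "r \<noteq> ?n"
    using step by auto
  have "(\<Sum>j\<in>S. x r (S - {j}) k j) + y r S k * of_bool (r \<noteq> 1) \<le> 1 / real ?n * ?inflow S"
    if "r \<le> card S" for S
  proof (cases "S = UNIV")
    case True
    then show ?thesis
      using feas r unfolding feasible_def Let_def by fastforce
  next
    case False
    then have "S \<noteq> {}" "S \<subset> UNIV"
      using that r by auto
    then have "(\<Sum>j\<in>S. x r (S - {j}) k j) + y r S k * of_bool (r \<noteq> 1)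
          - 1 / real ?n * of_bool (card S > r) * (\<Sum>k\<in>UNIV. y (r + 1) S k)
          - 1 / real ?n * (\<Sum>k\<in>UNIV. \<Sum>j\<in>UNIV - S. x (r + 1) S k j) \<le> 0"
      using feas r that unfolding feasible_def Let_def by blast
    then show ?thesis
      by (simp add: Compl_eq_Diff_UNIV algebra_simps)
  qed
  then have "(\<Sum>S | r \<le> card S. (\<Sum>j\<in>S. x r (S - {j}) k j) + y r S k * of_bool (r \<noteq> 1 \<or> r = ?n))
      \<le> (\<Sum>S | r \<le> card S. 1 / real ?n * ?inflow S)"
    using r by (intro sum_mono) simp
  also have "\<dots> = 1 / real ?n * (\<Sum>S | r \<le> card S. ?inflow S)"
    by (simp only: sum_distrib_left)
  also have "(\<Sum>S | r \<le> card S. ?inflow S)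
      = (\<Sum>k\<in>UNIV. \<Sum>S | r + 1 \<le> card S. (\<Sum>j\<in>S. x (r + 1) (S - {j}) k j) + y (r + 1) S k)"
  proof -
    have "(\<Sum>S | r \<le> card S. of_bool (card S > r) * (\<Sum>k\<in>UNIV. y (r + 1) S k))
        = (\<Sum>S | r + 1 \<le> card S. \<Sum>k\<in>UNIV. y (r + 1) S k)"
      by (rule sum.mono_neutral_cong_right) auto
    also have "\<dots> = (\<Sum>k\<in>UNIV. \<Sum>S | r + 1 \<le> card S. y (r + 1) S k)"
      by (rule sum.swap)
    finally have 1: "(\<Sum>S | r \<le> card S. of_bool (card S > r) * (\<Sum>k\<in>UNIV. y (r + 1) S k)) = \<dots>" .
    have "(\<Sum>S | r \<le> card S. \<Sum>j\<in>-S. x (r + 1) S k j)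
        = (\<Sum>S | r + 1 \<le> card S. \<Sum>j\<in>S. x (r + 1) (S - {j}) k j)" for k
    proof -
      \<comment> \<open>Regroup the matches by the set available before them: \<open>S\<close> with
        \<open>j\<close> outside it becomes \<open>insert j S\<close> with the marked element
        \<open>j\<close>, so the size bound rises by one.\<close>
      have "(\<Sum>(S, j)\<in>(SIGMA S:{S. r \<le> card S}. - S). x (r + 1) S k j)
          = (\<Sum>(S, j)\<in>(SIGMA S:{S. r + 1 \<le> card S}. S). x (r + 1) (S - {j}) k j)"
        by (rule sum.reindex_bij_witness[where i = "\<lambda>(S, j). (S - {j}, j)"
              and j = "\<lambda>(S, j). (insert j S, j)"]) auto
      then show ?thesis
        by (simp add: sum.Sigma)
    qed
    then have 2: "(\<Sum>S | r \<le> card S. \<Sum>k\<in>UNIV. \<Sum>j\<in>-S. x (r + 1) S k j)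
        = (\<Sum>k\<in>UNIV. \<Sum>S | r + 1 \<le> card S. \<Sum>j\<in>S. x (r + 1) (S - {j}) k j)"
      by (subst sum.swap) simp
    show ?thesis
      unfolding sum.distrib 1 2 by simp
  qed
  \<comment> \<open>As \<open>r + 1\<close> is not 1, the induction hypothesis counts the discards
    of that stage in full. The n types, of mass at most 1/n each, bring a total inflow of at most
    1.\<close>
  also have "1 / real ?n * \<dots> \<le> 1 / real ?n * (\<Sum>k\<in>(UNIV :: 'i set). 1 / real ?n)"
    using step.IH r by (intro mult_left_mono sum_mono) auto
  also have "\<dots> = 1 / real ?n"
    by (simp add: card)
  finally show ?case .
qed

text \<open>Indexed by the set \<open>insert j S\<close> available before the match, the row sum
  becomes the matching part of the mass bounded in \<open>feasible_mass_le\<close>; the discards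
  added to it are nonnegative.\<close>

lemma achievable_sum_le:
  fixes z :: "real ^ 'v::finite ^ 'i::finite ^ 'v stage"
  assumes z: "z \<in> achievable" and card: "CARD('i) = CARD('v)"
  shows "(\<Sum>j\<in>UNIV. z $ t $ i $ j) \<le> 1 / real CARD('v)"
proof -
  obtain x y where feas: "feasible x y"
    and z: "\<And>t i j. z $ t $ i $ j =
        (\<Sum>S | S \<subseteq> UNIV - {j} \<and> card S \<ge> stage_no t - 1. x (stage_no t) S i j)"
    using z unfolding achievable_def by auto
  define r where "r = stage_no t"
  have r: "1 \<le> r" "r \<le> CARD('v)"
    using stage_no[of t] by (auto simp: r_def)
  have "(\<Sum>j\<in>UNIV. z $ t $ i $ j)
      = (\<Sum>(j, S)\<in>(SIGMA j:UNIV. {S. S \<subseteq> UNIV - {j} \<and> card S \<ge> r - 1}). x r S i j)"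
    by (simp add: z r_def sum.Sigma)
  also have "\<dots> = (\<Sum>(S, j)\<in>(SIGMA S:{S. r \<le> card S}. S). x r (S - {j}) i j)"
    using r by (intro sum.reindex_bij_witness[where i = "\<lambda>(S, j). (j, S - {j})"
          and j = "\<lambda>(j, S). (insert j S, j)"]) (auto simp: card_insert_if intro!: arg_cong[where f = "\<lambda>S. x r S i _"])
  also have "\<dots> = (\<Sum>S | r \<le> card S. \<Sum>j\<in>S. x r (S - {j}) i j)"
    by (simp add: sum.Sigma)
  also have "\<dots> \<le> (\<Sum>S | r \<le> card S. (\<Sum>j\<in>S. x r (S - {j}) i j)
      + y r S i * of_bool (r \<noteq> 1 \<or> r = CARD('v)))"
    using feas r unfolding feasible_def Let_def by (intro sum_mono) auto
  also have "\<dots> \<le> 1 / real CARD('v)"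
    by (rule feasible_mass_le[OF feas card r])
  finally show ?thesis .
qed

section \<open>Achievability of points that match in at most two stages\<close>

text \<open>\<open>P r S\<close> is the probability that the ads \<open>S\<close> are available at the start of stage \<open>r\<close>.\<close>

lemma feasibleI_state_prob:
  fixes x :: "nat \<Rightarrow> 'v::finite set \<Rightarrow> 'i::finite \<Rightarrow> 'v \<Rightarrow> real"
    and P :: "nat \<Rightarrow> 'v set \<Rightarrow> real"
  assumes x: "\<And>r S k j. x r S k j \<ge> 0" and y: "\<And>r S k. y r S k \<ge> 0"
    and y0: "\<And>r S k. card S < r \<Longrightarrow> r \<le> CARD('v) \<Longrightarrow> y r S k = 0"
    and init: "P CARD('v) UNIV \<le> 1"
    and outflow: "\<And>r S k. 1 \<le> r \<Longrightarrow>
      (\<Sum>j\<in>S. x r (S - {j}) k j) + y r S k \<le> P r S / real CARD('v)"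
    and inflow: "\<And>r S. r < CARD('v) \<Longrightarrow>
      P r S \<le> (\<Sum>k\<in>UNIV. y (r + 1) S k) + (\<Sum>k\<in>UNIV. \<Sum>j\<in>-S. x (r + 1) S k j)"
  shows "feasible x y"
proof -
  let ?n = "CARD('v)"
  have start: "(\<Sum>j\<in>UNIV. x ?n (UNIV - {j}) k j) + y ?n UNIV k \<le> 1 / real ?n" for k
  proof -
    have "P ?n UNIV / real ?n \<le> 1 / real ?n"
      using init by (simp add: divide_right_mono)
    then show ?thesis
      using outflow[of ?n UNIV k] by simp
  qed
  have step: "(\<Sum>j\<in>S. x r (S - {j}) k j) + y r S k * of_bool (r \<noteq> 1)
          - 1 / real ?n * of_bool (card S > r) * (\<Sum>k\<in>UNIV. y (r + 1) S k)
          - 1 / real ?n * (\<Sum>k\<in>UNIV. \<Sum>j\<in>UNIV - S. x (r + 1) S k j) \<le> 0" if "r \<in> {1..?n - 1}" for r S k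
  proof -
    have r: "1 \<le> r" "r < ?n"
      using that by auto
    have "(\<Sum>j\<in>S. x r (S - {j}) k j) + y r S k * of_bool (r \<noteq> 1)
        \<le> (\<Sum>j\<in>S. x r (S - {j}) k j) + y r S k"
      using y by simp
    also have "\<dots> \<le> P r S / real ?n"
      by (rule outflow[OF r(1)])
    also have "\<dots> \<le> ((\<Sum>k\<in>UNIV. y (r + 1) S k)
        + (\<Sum>k\<in>UNIV. \<Sum>j\<in>-S. x (r + 1) S k j)) / real ?n"
      by (intro divide_right_mono inflow r) simp
    \<comment> \<open>By \<open>y0\<close> the discards vanish on sets with at most \<open>r\<close>
      ads, so the indicator in the constraint can be inserted without loss.\<close>
    also have "(\<Sum>k\<in>UNIV. y (r + 1) S k) = of_bool (card S > r) * (\<Sum>k\<in>UNIV. y (r + 1) S k)"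
      using y0[of S "r + 1"] r by auto
    finally show ?thesis
      by (simp add: Compl_eq_Diff_UNIV add_divide_distrib)
  qed
  have step_UNIV: "(\<Sum>j\<in>UNIV. x r (UNIV - {j}) k j) + y r UNIV k * of_bool (r \<noteq> 1)
          - 1 / real ?n * (\<Sum>k\<in>UNIV. y (r + 1) UNIV k) \<le> 0" if "r \<in> {1..?n - 1}" for r k
    using step[OF that, of UNIV k] that by (cases "r < ?n") auto
  show ?thesis
    unfolding feasible_def Let_def
    by (intro conjI ballI allI impI x y start step step_UNIV) auto
qed

text \<open>
  The policy matches in stage \<open>u\<close> some types to \<open>\<alpha>\<close> and in the later stage \<open>w\<close> some types to
  \<open>\<beta>\<close>; taking \<open>w = 0\<close> leaves only the stage \<open>u\<close>.
\<close>

lemma two_stage_achievable: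
  fixes z :: "real ^ 'v::finite ^ 'i::finite ^ 'v stage" and c d :: "'i \<Rightarrow> real"
  assumes card: "CARD('i) = CARD('v)"
    and u: "u \<le> CARD('v)" and wu: "w < u" and neq: "\<alpha> \<noteq> \<beta> \<or> w = 0"
    and c: "\<And>k. 0 \<le> c k" "\<And>k. c k \<le> 1 / real CARD('v)"
    and d: "\<And>k. 0 \<le> d k" "\<And>k. d k \<le> 1 / real CARD('v)"
    and z: "\<And>s k j. z $ s $ k $ j =
      of_bool (stage_no s = u \<and> j = \<alpha>) * c k + of_bool (stage_no s = w \<and> j = \<beta>) * d k"
  shows "z \<in> achievable"
proof -
  let ?n = "CARD('v)"
  \<comment> \<open>The probability that \<alpha> is used up in stage \<open>u\<close>.\<close>
  define q where "q = (\<Sum>k\<in>UNIV. c k)"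
  have q: "0 \<le> q" "q \<le> 1"
  proof -
    show "0 \<le> q"
      unfolding q_def by (intro sum_nonneg c)
    have "q \<le> (\<Sum>k\<in>(UNIV::'i set). 1 / real ?n)"
      unfolding q_def by (intro sum_mono c)
    then show "q \<le> 1"
      by (simp add: card)
  qed
  \<comment> \<open>In stage \<open>w\<close> the available set is everything with probability
    \<open>1 - q\<close> and \<open>-{\<alpha>}\<close> with probability \<open>q\<close>; type
    \<open>k\<close> takes \<beta> in proportion \<open>d k\<close> in both cases. The index
    \<open>S\<close> is the set left after the match.\<close>
  define x :: "nat \<Rightarrow> 'v set \<Rightarrow> 'i \<Rightarrow> 'v \<Rightarrow> real" where
    "x = (\<lambda>r S k j. of_bool (r = u \<and> j = \<alpha>) * of_bool (S = -{\<alpha>}) * c k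
      + of_bool (r = w \<and> j = \<beta>) * (of_bool (S = -{\<beta>}) * (1 - q) + of_bool (S = -{\<alpha>, \<beta>}) * q) * d k)"
  \<comment> \<open>Before stage \<open>u\<close> and strictly between the two stages everything is
    discarded, in stage \<open>u\<close> whatever is not matched. From stage \<open>w\<close> on
    nothing needs to be passed on, since the constraints are only upper bounds.\<close>
  define y :: "nat \<Rightarrow> 'v set \<Rightarrow> 'i \<Rightarrow> real" where
    "y = (\<lambda>r S k. if u < r then of_bool (S = UNIV) / real ?n
      else if r = u then of_bool (S = UNIV) * (1 / real ?n - c k)
      else if w < r then (of_bool (S = UNIV) * (1 - q) + of_bool (S = -{\<alpha>}) * q) / real ?n
      else 0)"
  define P :: "nat \<Rightarrow> 'v set \<Rightarrow> real" where
    "P = (\<lambda>r S. if u \<le> r then of_bool (S = UNIV)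
      else if w \<le> r then of_bool (S = UNIV) * (1 - q) + of_bool (S = -{\<alpha>}) * q
      else 0)"
  have x_state: "(\<Sum>j\<in>S. x r (S - {j}) k j) = of_bool (r = u \<and> S = UNIV) * c k
      + of_bool (r = w) * (of_bool (S = UNIV) * (1 - q) + of_bool (S = -{\<alpha>}) * q) * d k"
    if "1 \<le> r" for r S k
  proof -
    have "x r (S - {j}) k j = (if j = \<alpha> then of_bool (r = u \<and> S = UNIV) * c k else 0)
        + (if j = \<beta> then of_bool (r = w) * (of_bool (S = UNIV) * (1 - q) + of_bool (S = -{\<alpha>}) * q) * d k
           else 0)" if "j \<in> S" for j
    proof -
      have "S - {j} = -{j} \<longleftrightarrow> S = UNIV"
        using that by auto
      \<comment> \<open>Distinctness of the two ads comes from \<open>neq\<close>: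
        \<open>r = w\<close> and \<open>1 \<le> r\<close> exclude the alternative
        \<open>w = 0\<close>.\<close>
      moreover have "S - {\<beta>} = -{\<alpha>, \<beta>} \<longleftrightarrow> S = -{\<alpha>}" if "j = \<beta>" "r = w"
      proof -
        have "\<alpha> \<noteq> \<beta>"
          using neq \<open>1 \<le> r\<close> that by simp
        then show ?thesis
          using \<open>j \<in> S\<close> that by auto
      qed
      ultimately show ?thesis
        by (auto simp: x_def)
    qed
    then have "(\<Sum>j\<in>S. x r (S - {j}) k j)
        = of_bool (\<alpha> \<in> S) * of_bool (r = u \<and> S = UNIV) * c k
        + of_bool (\<beta> \<in> S) * of_bool (r = w) * (of_bool (S = UNIV) * (1 - q) + of_bool (S = -{\<alpha>}) * q) * d k"
      by (simp add: sum.distrib sum.delta)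
    also have "\<dots> = of_bool (r = u \<and> S = UNIV) * c k
        + of_bool (r = w) * (of_bool (S = UNIV) * (1 - q) + of_bool (S = -{\<alpha>}) * q) * d k"
      using neq that by auto
    finally show ?thesis .
  qed
  have x_next: "(\<Sum>k\<in>UNIV. \<Sum>j\<in>-S. x u S k j) = of_bool (S = -{\<alpha>}) * q" for S
  proof -
    have "x u S k j = (if j = \<alpha> then of_bool (S = -{\<alpha>}) * c k else 0)" for k j
      using wu by (simp add: x_def)
    then have "(\<Sum>j\<in>-S. x u S k j) = of_bool (S = -{\<alpha>}) * c k" for k
      by (auto simp: sum.delta)
    then show ?thesis
      by (simp add: q_def sum_distrib_left)
  qed
  have x0: "0 \<le> x r S k j" for r S k j
    using q c d by (simp add: x_def)
  have "feasible x y"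
  proof (rule feasibleI_state_prob[where P = P])
    show "0 \<le> y r S k" for r S k
      using q c by (simp add: y_def)
    \<comment> \<open>The set \<open>-{\<alpha>}\<close> carries discards only in stages
      \<open>r < u \<le> n\<close>, where its n - 1 ads suffice.\<close>
    show "y r S k = 0" if "card S < r" "r \<le> ?n" for r S k
    proof -
      have "card (-{\<alpha>}) = ?n - 1"
        by (simp add: Compl_eq_Diff_UNIV)
      then show ?thesis
        using that u by (auto simp: y_def)
    qed
    show "P ?n UNIV \<le> 1"
      using u by (simp add: P_def)
    show "(\<Sum>j\<in>S. x r (S - {j}) k j) + y r S k \<le> P r S / real ?n" if "1 \<le> r" for r S k
    proof -
      have "p * d k \<le> p / real ?n" if "0 \<le> p" for p
        using mult_left_mono[OF d(2) that] by simp
      then have "(of_bool (S = UNIV) * (1 - q) + of_bool (S = -{\<alpha>}) * q) * d k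
          \<le> (of_bool (S = UNIV) * (1 - q) + of_bool (S = -{\<alpha>}) * q) / real ?n"
        using q by simp
      then show ?thesis
        using wu u unfolding x_state[OF that] by (auto simp: y_def P_def)
    qed
    show "P r S \<le> (\<Sum>k\<in>UNIV. y (r + 1) S k) + (\<Sum>k\<in>UNIV. \<Sum>j\<in>-S. x (r + 1) S k j)"
      if "r < ?n" for r S
    proof -
      have x_sum: "0 \<le> (\<Sum>k\<in>UNIV. \<Sum>j\<in>-S. x (r + 1) S k j)"
        by (intro sum_nonneg x0)
      \<comment> \<open>Stage \<open>r + 1\<close> lies before \<open>u\<close>, is
        \<open>u\<close>, lies strictly between the two stages, or is \<open>w\<close> or later. In
        the last case \<open>P r S = 0\<close> and nonnegativity is enough.\<close>
      consider "u < r + 1" | "r + 1 = u" | "w < r + 1" "r + 1 < u" | "r + 1 \<le> w"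
        by linarith
      then show ?thesis
      proof cases
        case 2
        then have "(\<Sum>k\<in>UNIV. y (r + 1) S k) = of_bool (S = UNIV) * (1 - q)"
          by (simp add: y_def q_def card sum_subtractf flip: sum_distrib_left)
        then show ?thesis
          using 2 x_next q by (auto simp: P_def)
      qed (use x_sum wu in \<open>auto simp: y_def P_def card\<close>)
    qed
  qed (rule x0)
  moreover have "z $ s $ k $ j =
      (\<Sum>S | S \<subseteq> UNIV - {j} \<and> card S \<ge> stage_no s - 1. x (stage_no s) S k j)" for s k j
  proof -
    define r where "r = stage_no s"
    define A where "A = {S. S \<subseteq> UNIV - {j} \<and> card S \<ge> r - 1}"
    have r: "1 \<le> r" "r \<le> ?n"
      using stage_no[of s] by (auto simp: r_def)
    have delta: "(\<Sum>S\<in>A. of_bool (S = T) * a) = of_bool (T \<in> A) * a" for T and a :: real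
    proof -
      have "(\<Sum>S\<in>A. of_bool (S = T) * a) = (\<Sum>S\<in>A. if S = T then a else 0)"
        by (intro sum.cong) auto
      then show ?thesis
        by (simp add: sum.delta)
    qed
    have "x r S k j = of_bool (r = u \<and> j = \<alpha>) * (of_bool (S = -{\<alpha>}) * c k)
        + of_bool (r = w \<and> j = \<beta>)
          * (of_bool (S = -{\<beta>}) * ((1 - q) * d k) + of_bool (S = -{\<alpha>, \<beta>}) * (q * d k))" for S
      by (simp add: x_def algebra_simps)
    then have "(\<Sum>S\<in>A. x r S k j)
        = of_bool (r = u \<and> j = \<alpha>) * (of_bool (-{\<alpha>} \<in> A) * c k)
        + of_bool (r = w \<and> j = \<beta>)
          * (of_bool (-{\<beta>} \<in> A) * ((1 - q) * d k) + of_bool (-{\<alpha>, \<beta>} \<in> A) * (q * d k))"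
      by (simp only: sum.distrib delta flip: sum_distrib_left)
    also have "\<dots> = of_bool (r = u \<and> j = \<alpha>) * c k + of_bool (r = w \<and> j = \<beta>) * d k"
    proof -
      have "-{j} \<in> A"
        using r by (auto simp: A_def Compl_eq_Diff_UNIV)
      \<comment> \<open>From \<open>w < u \<le> n\<close> follows n - 2 \<ge> w - 1, so this set is
        within the index range of stage \<open>w\<close>. The shares \<open>1 - q\<close> and
        \<open>q\<close> then add up to the full \<open>d k\<close>.\<close>
      moreover have "-{\<alpha>, \<beta>} \<in> A" if "r = w" "j = \<beta>"
      proof -
        have "card (-{\<alpha>, \<beta>}) = ?n - 2"
          using neq r that by (simp add: Compl_eq_Diff_UNIV card_Diff_subset)
        then show ?thesis
          using that wu u by (auto simp: A_def)
      qed
      ultimately show ?thesis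
        by (auto simp: algebra_simps)
    qed
    finally show ?thesis
      by (simp add: z r_def A_def)
  qed
  ultimately show ?thesis
    unfolding achievable_def by blast
qed

section \<open>Dimension: the affine hull of the face\<close>

lemma vec3_expansion:
  fixes z :: "real ^ 'c::finite ^ 'b::finite ^ 'a::finite"
  shows "z = (\<Sum>s\<in>UNIV. \<Sum>k\<in>UNIV. \<Sum>j\<in>UNIV. (z $ s $ k $ j) *\<^sub>R axis s (axis k (axis j 1)))"
proof -
  have "(\<Sum>j\<in>UNIV. (z $ s $ k $ j) *\<^sub>R axis s (axis k (axis j 1))) $ a $ b $ c
      = (if k = b then if s = a then z $ a $ b $ c else 0 else 0)" for s k a b c
    by (auto simp: axis_def if_distrib[where f = "(*) _"] sum.delta cong: if_cong)
  then show ?thesis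
    by (simp add: vec_eq_iff sum.delta)
qed

text \<open>Differences of face points yield every unit vector outside the row \<open>(t, i)\<close>
  and every difference of two unit vectors inside it. These span all directions of the hyperplane,
  so no affinely independent points have to be counted.\<close>

lemma affine_hull_face_eq:
  fixes i :: "'i::finite" and t :: "'v::finite stage"
  assumes card: "CARD('i) = CARD('v)"
  shows "affine hull {z \<in> (achievable :: (real ^ 'v ^ 'i ^ 'v stage) set).
             (\<Sum>j\<in>UNIV. z $ t $ i $ j) = 1 / real CARD('v)}
           = {z. (\<Sum>j\<in>UNIV. z $ t $ i $ j) = 1 / real CARD('v)}"
    (is "affine hull ?F = ?H")
proof
  let ?n = "CARD('v)"
  define e :: "'v stage \<Rightarrow> 'i \<Rightarrow> 'v \<Rightarrow> real ^ 'v ^ 'i ^ 'v stage"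
    where "e = (\<lambda>s k j. axis s (axis k (axis j 1)))"
  have e: "e s k j $ s' $ k' $ j' = of_bool (s' = s \<and> k' = k \<and> j' = j)" for s k j s' k' j'
    by (simp add: e_def axis_def)
  have row: "(\<Sum>j'\<in>UNIV. (e s k j /\<^sub>R ?n) $ t $ i $ j') = of_bool (s = t \<and> k = i) / ?n" for s k j
    by (cases "s = t \<and> k = i") (auto simp: e divide_inverse_commute)
  have "affine ?H"
    by (simp add: affine_def sum.distrib flip: sum_distrib_left add_divide_distrib)
  then show "affine hull ?F \<subseteq> ?H"
    by (intro hull_minimal) auto
  have t: "stage_no t \<le> ?n" "0 < stage_no t"
    using stage_no[of t] by auto
  have single: "e t i j /\<^sub>R ?n \<in> ?F" for j
  proof -
    have "e t i j /\<^sub>R ?n \<in> achievable"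
      by (rule two_stage_achievable[where u = "stage_no t" and w = 0 and \<alpha> = j and \<beta> = j
            and c = "\<lambda>k. of_bool (k = i) / ?n" and d = "\<lambda>k. 0"])
        (use card t in \<open>auto simp: e stage_no_inject inverse_eq_divide\<close>)
    then show ?thesis
      by (simp add: row del: vector_scaleR_component)
  qed
  have pair: "\<exists>j'. e t i j' /\<^sub>R ?n + e s k j /\<^sub>R ?n \<in> ?F" if ne: "(s, k) \<noteq> (t, i)" for s k j
  proof (cases "s = t")
    case True
    \<comment> \<open>Within one stage both types may use the same ad, because only one of them
      appears.\<close>
    then have "e t i j /\<^sub>R ?n + e s k j /\<^sub>R ?n \<in> achievable"
      by (intro two_stage_achievable[where u = "stage_no t" and w = 0 and \<alpha> = j and \<beta> = j
            and c = "\<lambda>k'. of_bool (k' = i \<or> k' = k) / ?n" and d = "\<lambda>k. 0"])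
        (use card t ne in \<open>auto simp: e stage_no_inject inverse_eq_divide\<close>)
    then show ?thesis
      using True ne by (intro exI[of _ j]) (simp add: sum.distrib row del: vector_scaleR_component)
  next
    case False
    have s: "stage_no s \<le> ?n" "0 < stage_no s" "stage_no s \<noteq> stage_no t"
      using stage_no[of s] False by (auto simp: stage_no_inject)
    \<comment> \<open>Two different stages force n \<ge> 2, so there is a second ad.\<close>
    have "\<exists>j'. j' \<noteq> j"
    proof (rule ccontr)
      assume "\<not> ?thesis"
      then have "UNIV = {j}"
        by auto
      then have "?n = 1"
        by (metis card_1_singleton_iff One_nat_def)
      then show False
        using s t by linarith
    qed
    then obtain j' where j': "j' \<noteq> j"
      by blast
    \<comment> \<open>Stages are counted down: whichever of \<open>s\<close> and \<open>t\<close>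
      has the larger number comes first and takes the part of \<open>u\<close>.\<close>
    have "e t i j' /\<^sub>R ?n + e s k j /\<^sub>R ?n \<in> achievable"
    proof (cases "stage_no s < stage_no t")
      case True
      then show ?thesis
        by (intro two_stage_achievable[where u = "stage_no t" and w = "stage_no s" and \<alpha> = j' and \<beta> = j
              and c = "\<lambda>k'. of_bool (k' = i) / ?n" and d = "\<lambda>k'. of_bool (k' = k) / ?n"])
          (use card t s j' in \<open>auto simp: e stage_no_inject inverse_eq_divide\<close>)
    next
      case False
      then have "stage_no t < stage_no s"
        using s by simp
      then show ?thesis
        by (intro two_stage_achievable[where u = "stage_no s" and w = "stage_no t" and \<alpha> = j and \<beta> = j'
              and c = "\<lambda>k'. of_bool (k' = k) / ?n" and d = "\<lambda>k'. of_bool (k' = i) / ?n"])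
          (use card t s j' in \<open>auto simp: e stage_no_inject inverse_eq_divide\<close>)
    qed
    then show ?thesis
      using \<open>s \<noteq> t\<close> by (intro exI[of _ j']) (simp add: sum.distrib row del: vector_scaleR_component)
  qed
  fix j0 :: 'v
  define p where "p = e t i j0 /\<^sub>R ?n"
  \<comment> \<open>The direction space of the hull, based at the face point
    \<open>p\<close>.\<close>
  define L where "L = {v - p |v. v \<in> affine hull ?F}"
  have p: "p \<in> affine hull ?F"
    using single[of j0] by (auto simp: p_def intro: hull_inc)
  have L: "subspace L"
    unfolding L_def using affine_diffs_subspace_subtract[OF affine_affine_hull p]
    by (simp add: setcompr_eq_image)
  have diff: "v - w \<in> L" if "v \<in> ?F" "w \<in> ?F" for v w
  proof -
    have "v - p \<in> L" "w - p \<in> L"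
      using that by (auto simp: L_def intro!: exI[where P = "\<lambda>v. _ v \<and> _ v"] hull_inc)
    then show ?thesis
      using subspace_diff[OF L, of "v - p" "w - p"] by simp
  qed
  have scale: "v \<in> L" if "v /\<^sub>R ?n \<in> L" for v
    using subspace_scale[OF L that, of "real ?n"] by simp
  have L_other: "e s k j \<in> L" if ne: "(s, k) \<noteq> (t, i)" for s k j
  proof -
    obtain j' where "e t i j' /\<^sub>R ?n + e s k j /\<^sub>R ?n \<in> ?F"
      using pair[OF ne] by blast
    then have "e t i j' /\<^sub>R ?n + e s k j /\<^sub>R ?n - e t i j' /\<^sub>R ?n \<in> L"
      by (rule diff[OF _ single])
    then show ?thesis
      by (intro scale[of "e s k j"]) simp
  qed
  have L_row: "e t i j - e t i j0 \<in> L" for j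
    using diff[OF single[of j] single[of j0]]
    by (intro scale[of "e t i j - e t i j0"]) (simp add: scaleR_diff_right)
  show "?H \<subseteq> affine hull ?F"
  proof
    fix z assume "z \<in> ?H"
    then have z: "(\<Sum>j\<in>UNIV. z $ t $ i $ j) = 1 / real ?n"
      by simp
    have row_sum: "(\<Sum>j\<in>UNIV. (z $ s $ k $ j) *\<^sub>R (if s = t then if k = i then e t i j0 else 0 else 0))
        = (if k = i then if s = t then (\<Sum>j\<in>UNIV. z $ t $ i $ j) *\<^sub>R e t i j0 else 0 else 0)" for s k
      by (simp add: scaleR_sum_left)
    \<comment> \<open>As the row \<open>(t, i)\<close> of \<open>z\<close> sums to 1/n,
      \<open>p\<close> is that row collapsed onto \<open>j0\<close>. Subtracting it termwise turns
      each \<open>e t i j\<close> in the expansion of \<open>z\<close> into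
      \<open>e t i j - e t i j0\<close>, which lies in \<open>L\<close>.\<close>
    have "p = (\<Sum>j\<in>UNIV. z $ t $ i $ j) *\<^sub>R e t i j0"
      by (simp add: p_def z inverse_eq_divide)
    also have "\<dots> = (\<Sum>s\<in>UNIV. \<Sum>k\<in>UNIV. \<Sum>j\<in>UNIV.
        (z $ s $ k $ j) *\<^sub>R (if s = t then if k = i then e t i j0 else 0 else 0))"
      unfolding row_sum by (simp add: sum.delta)
    finally have "z - p = (\<Sum>s\<in>UNIV. \<Sum>k\<in>UNIV. \<Sum>j\<in>UNIV.
        (z $ s $ k $ j) *\<^sub>R (e s k j - (if s = t then if k = i then e t i j0 else 0 else 0)))"
      unfolding e_def by (subst vec3_expansion[of z]) (simp only: scaleR_diff_right sum_subtractf)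
    also have "\<dots> \<in> L"
      using L_other L_row by (intro subspace_sum[OF L] subspace_scale[OF L]) auto
    finally show "z \<in> affine hull ?F"
      by (auto simp: L_def)
  qed
qed

theorem proposition1:
  fixes i :: "'i::finite" and t :: "'v::finite stage"
  assumes "CARD('i) = CARD('v)"
  shows "facet_defining (achievable :: (real ^ 'v ^ 'i ^ 'v stage) set)
           (\<lambda>z. \<Sum>j\<in>UNIV. z $ t $ i $ j) (1 / real CARD('v))"
proof -
  \<comment> \<open>The normal vector of the hyperplane: ones in the row \<open>(t, i)\<close>,
    zeros elsewhere.\<close>
  let ?a = "axis t (axis i (\<chi> j. 1)) :: real ^ 'v ^ 'i ^ 'v stage"
  have f: "(\<Sum>j\<in>UNIV. z $ t $ i $ j) = ?a \<bullet> z" for z :: "real ^ 'v ^ 'i ^ 'v stage"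
    by (simp add: inner_axis' inner_vec_def[of "\<chi> j. 1"])
  have a: "?a \<noteq> 0"
  proof
    assume "?a = 0"
    then have "?a $ t $ i $ j = 0" for j
      by simp
    then show False
      by simp
  qed
  show ?thesis
    unfolding facet_defining_def
  proof
    show "\<forall>z\<in>(achievable :: (real ^ 'v ^ 'i ^ 'v stage) set).
        (\<Sum>j\<in>UNIV. z $ t $ i $ j) \<le> 1 / real CARD('v)"
      using achievable_sum_le[OF _ assms] by blast
    show "aff_dim {z \<in> (achievable :: (real ^ 'v ^ 'i ^ 'v stage) set).
        (\<Sum>j\<in>UNIV. z $ t $ i $ j) = 1 / real CARD('v)} = int DIM(real ^ 'v ^ 'i ^ 'v stage) - 1"
      (is "aff_dim ?F = _")
    proof -
      have "aff_dim ?F = aff_dim (affine hull ?F)"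
        by (simp only: aff_dim_affine_hull)
      also have "\<dots> = aff_dim {z. ?a \<bullet> z = 1 / real CARD('v)}"
        by (simp only: f affine_hull_face_eq[OF assms, of t i, unfolded f])
      also have "\<dots> = int (DIM(real ^ 'v ^ 'i ^ 'v stage) - 1)"
        by (rule aff_dim_hyperplane[OF a])
      also have "\<dots> = int DIM(real ^ 'v ^ 'i ^ 'v stage) - 1"
        using DIM_positive[where 'a = "real ^ 'v ^ 'i ^ 'v stage"] by linarith
      finally show ?thesis .
    qed
  qed
qed

end
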